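(* Let $\mathcal{LC}$ be the local-causal polytope of conditional distributions $p(a_1a_2bc\mid x_1x_2yz)$ with all variables binary (defined in the context). If $p\in\mathcal{LC}$ then $$p(b=0, a_2=x_1 \mid y=0) + p(b=1, a_1=x_2 \mid y=0) + p(b\oplus c = yz\mid x_1=x_2=0) \leq \frac74,$$ and this bound is attained by some $p\in\mathcal{LC}$.
   Context: All settings $x_1,x_2,y,z$ and outcomes $a_1,a_2,b,c$ take values in $\{0,1\}$; $\oplus$ is addition mod 2. Let $\mathcal P$ be the set of all conditional probability distributions $p(a_1a_2bc\mid x_1x_2yz)$. For a set $S$ of outcome variables and a set $T$ of setting variables, write $S\perp_p T$ to mean that the marginal $\sum_{\text{outcomes not in }S} p(a_1a_2bc\mid x_1x_2yz)$ is, for every value of the outcomes in $S$ and of the settings not in $T$, independent of the values of the settings in $T$. Define $\mathcal{NS}=\{p\in\mathcal P: \{a_1,a_2,c\}\perp_p \{y\}\text{ and } \{b\}\perp_p\{x_1,x_2,z\}\}$; $\mathcal{LC}_1=\{p\in\mathcal{NS}: \{a_1,b\}\perp_p\{x_2\}\text{ and }\{a_1,a_2,b\}\perp_p\{z\}\}$; $\mathcal{LC}_2=\{p\in\mathcal{NS}: \{a_2,b\}\perp_p\{x_1\}\text{ and }\{a_1,a_2,b\}\perp_p\{z\}\}$; $\mathcal{LC}=\{\mu p_1+(1-\mu)p_2:\mu\in[0,1],\,p_1\in\mathcal{LC}_1,\,p_2\in\mathcal{LC}_2\}$. Shorthand (settings treated as uniformly and independently distributed): $p(b=0,a_2=x_1\mid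 y=0)=\frac18\sum_{x_1,x_2,z}p(b=0,a_2=x_1\mid x_1x_2,y=0,z)$; $p(b=1,a_1=x_2\mid y=0)=\frac18\sum_{x_1,x_2,z}p(b=1,a_1=x_2\mid x_1x_2,y=0,z)$; $p(b\oplus c=yz\mid x_1=x_2=0)=\frac14\sum_{y,z}p(b\oplus c=yz\mid x_1=x_2=0,y,z)$, where each event probability is the sum of $p(a_1a_2bc\mid x_1x_2yz)$ over outcomes satisfying the event. *)

theory Defs
  imports Complex_Main
begin

text \<open>Binary values 0/1 are encoded as False/True; xor is (\<noteq>) and product is (\<and>).
  A behaviour p maps (a1 a2 b c x1 x2 y z) to p(a1 a2 b c | x1 x2 y z).\<close>

type_synonym behav = "bool \<Rightarrow> bool \<Rightarrow> bool \<Rightarrow> bool \<Rightarrow> bool \<Rightarrow> bool \<Rightarrow> bool \<Rightarrow> bool \<Rightarrow> real"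

definition cond_dist :: "behav \<Rightarrow> bool" where
  "cond_dist p \<longleftrightarrow>
     (\<forall>a1 a2 b c x1 x2 y z. p a1 a2 b c x1 x2 y z \<ge> 0) \<and>
     (\<forall>x1 x2 y z. (\<Sum>a1\<in>UNIV. \<Sum>a2\<in>UNIV. \<Sum>b\<in>UNIV. \<Sum>c\<in>UNIV. p a1 a2 b c x1 x2 y z) = 1)"

definition NS :: "behav set" where
  "NS = {p. cond_dist p \<and>
     \<comment> \<open>{a1,a2,c} independent of {y}\<close>
     (\<forall>a1 a2 c x1 x2 y y' z.
        (\<Sum>b\<in>UNIV. p a1 a2 b c x1 x2 y z) = (\<Sum>b\<in>UNIV. p a1 a2 b c x1 x2 y' z)) \<and>
     \<comment> \<open>{b} independent of {x1,x2,z}\<close>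
     (\<forall>b y x1 x2 z x1' x2' z'.
        (\<Sum>a1\<in>UNIV. \<Sum>a2\<in>UNIV. \<Sum>c\<in>UNIV. p a1 a2 b c x1 x2 y z) =
        (\<Sum>a1\<in>UNIV. \<Sum>a2\<in>UNIV. \<Sum>c\<in>UNIV. p a1 a2 b c x1' x2' y z'))}"

definition ind_a1a2b_z :: "behav \<Rightarrow> bool" where
  "ind_a1a2b_z p \<longleftrightarrow> (\<forall>a1 a2 b x1 x2 y z z'.
      (\<Sum>c\<in>UNIV. p a1 a2 b c x1 x2 y z) = (\<Sum>c\<in>UNIV. p a1 a2 b c x1 x2 y z'))"

definition LC1 :: "behav set" where
  "LC1 = {p. p \<in> NS \<and>
     (\<forall>a1 b x1 x2 x2' y z.
        (\<Sum>a2\<in>UNIV. \<Sum>c\<in>UNIV. p a1 a2 b c x1 x2 y z) =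
        (\<Sum>a2\<in>UNIV. \<Sum>c\<in>UNIV. p a1 a2 b c x1 x2' y z)) \<and>
     ind_a1a2b_z p}"

definition LC2 :: "behav set" where
  "LC2 = {p. p \<in> NS \<and>
     (\<forall>a2 b x1 x1' x2 y z.
        (\<Sum>a1\<in>UNIV. \<Sum>c\<in>UNIV. p a1 a2 b c x1 x2 y z) =
        (\<Sum>a1\<in>UNIV. \<Sum>c\<in>UNIV. p a1 a2 b c x1' x2 y z)) \<and>
     ind_a1a2b_z p}"

definition LC :: "behav set" where
  "LC = {(\<lambda>a1 a2 b c x1 x2 y z. \<mu> * p1 a1 a2 b c x1 x2 y z + (1 - \<mu>) * p2 a1 a2 b c x1 x2 y z)
          | \<mu> p1 p2. 0 \<le> \<mu> \<and> \<mu> \<le> 1 \<and> p1 \<in> LC1 \<and> p2 \<in> LC2}"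

definition ev_prob :: "behav \<Rightarrow> (bool \<Rightarrow> bool \<Rightarrow> bool \<Rightarrow> bool \<Rightarrow> bool)
    \<Rightarrow> bool \<Rightarrow> bool \<Rightarrow> bool \<Rightarrow> bool \<Rightarrow> real" where
  "ev_prob p E x1 x2 y z =
     (\<Sum>a1\<in>UNIV. \<Sum>a2\<in>UNIV. \<Sum>b\<in>UNIV. \<Sum>c\<in>UNIV.
        if E a1 a2 b c then p a1 a2 b c x1 x2 y z else 0)"

definition score :: "behav \<Rightarrow> real" where
  "score p =
     (1/8) * (\<Sum>x1\<in>UNIV. \<Sum>x2\<in>UNIV. \<Sum>z\<in>UNIV.
        ev_prob p (\<lambda>a1 a2 b c. b = False \<and> a2 = x1) x1 x2 False z)
   + (1/8) * (\<Sum>x1\<in>UNIV. \<Sum>x2\<in>UNIV. \<Sum>z\<in>UNIV.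
        ev_prob p (\<lambda>a1 a2 b c. b = True \<and> a1 = x2) x1 x2 False z)
   + (1/4) * (\<Sum>y\<in>UNIV. \<Sum>z\<in>UNIV.
        ev_prob p (\<lambda>a1 a2 b c. (b \<noteq> c) = (y \<and> z)) False False y z)"

end

theory Submission
  imports Defs
begin

text \<open>The score is affine in the behaviour, and exchanging the two parties while flipping both b and
  c maps LC2 into LC1 without changing the score, so it suffices to treat LC1. Put
  \<beta> = p(b=0 | y=0). The first term is at most \<beta>. Since the joint law of a1 and b does
  not depend on x2, guessing a uniform x2 by a1 succeeds with probability 1/2 whatever b is, so the
  second term equals (1 - \<beta>)/2. Finally, without signalling a biased b limits the CHSH
  winning probability to 1 - |2\<beta> - 1|/4, which is at most 5/4 - \<beta>/2. Hence the score is at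
  most (1 + \<beta>)/2 + (5/4 - \<beta>/2) = 7/4.\<close>

lemma NS_imp_cond_dist: "p \<in> NS \<Longrightarrow> cond_dist p"
  by (simp add: NS_def)

lemma LC1_imp_NS: "p \<in> LC1 \<Longrightarrow> p \<in> NS"
  by (simp add: LC1_def)

lemma cond_dist_nonneg: "cond_dist p \<Longrightarrow> 0 \<le> p a1 a2 b c x1 x2 y z"
  by (simp add: cond_dist_def)

subsection \<open>Probabilities of events\<close>

lemma ev_prob_eq_sum_of_bool:
  "ev_prob p E x1 x2 y z = (\<Sum>a1\<in>UNIV. \<Sum>a2\<in>UNIV. \<Sum>b\<in>UNIV. \<Sum>c\<in>UNIV.
     of_bool (E a1 a2 b c) * p a1 a2 b c x1 x2 y z)"
  unfolding ev_prob_def by (intro sum.cong) auto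

lemma ev_prob_mono:
  assumes "cond_dist p"
    and "\<And>a1 a2 b c. E a1 a2 b c \<Longrightarrow> F a1 a2 b c"
  shows "ev_prob p E x1 x2 y z \<le> ev_prob p F x1 x2 y z"
  unfolding ev_prob_def using assms by (intro sum_mono) (auto simp: cond_dist_nonneg)

lemma ev_prob_disj_le:
  assumes "cond_dist p"
  shows "ev_prob p (\<lambda>a1 a2 b c. E a1 a2 b c \<or> F a1 a2 b c) x1 x2 y z
    \<le> ev_prob p E x1 x2 y z + ev_prob p F x1 x2 y z"
  unfolding ev_prob_def sum.distrib[symmetric]
  by (intro sum_mono) (auto simp: cond_dist_nonneg[OF assms])

lemma ev_prob_not:
  assumes "cond_dist p"
  shows "ev_prob p (\<lambda>a1 a2 b c. \<not> E a1 a2 b c) x1 x2 y z = 1 - ev_prob p E x1 x2 y z"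
proof -
  have "ev_prob p (\<lambda>a1 a2 b c. \<not> E a1 a2 b c) x1 x2 y z + ev_prob p E x1 x2 y z
      = (\<Sum>a1\<in>UNIV. \<Sum>a2\<in>UNIV. \<Sum>b\<in>UNIV. \<Sum>c\<in>UNIV. p a1 a2 b c x1 x2 y z)"
    unfolding ev_prob_def sum.distrib[symmetric] by (intro sum.cong) auto
  also have "\<dots> = 1"
    using assms by (simp add: cond_dist_def)
  finally show ?thesis
    by simp
qed

lemma ev_prob_total:
  "(\<Sum>v\<in>UNIV. ev_prob p (\<lambda>a1 a2 b c. E a1 a2 b c \<and> f a1 a2 b c = v) x1 x2 y z)
    = ev_prob p E x1 x2 y z" for f :: "bool \<Rightarrow> bool \<Rightarrow> bool \<Rightarrow> bool \<Rightarrow> bool"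
proof -
  have "ev_prob p (\<lambda>a1 a2 b c. E a1 a2 b c \<and> f a1 a2 b c = False) x1 x2 y z
      + ev_prob p (\<lambda>a1 a2 b c. E a1 a2 b c \<and> f a1 a2 b c = True) x1 x2 y z
      = ev_prob p E x1 x2 y z"
    unfolding ev_prob_def sum.distrib[symmetric] by (intro sum.cong) auto
  then show ?thesis
    by (simp add: UNIV_bool)
qed

lemma abs_ev_prob_diff_le:
  assumes "cond_dist p"
  shows "\<bar>ev_prob p E x1 x2 y z - ev_prob p F x1 x2 y z\<bar>
    \<le> 1 - ev_prob p (\<lambda>a1 a2 b c. E a1 a2 b c = F a1 a2 b c) x1 x2 y z"
proof -
  let ?D = "\<lambda>a1 a2 b c. E a1 a2 b c \<noteq> F a1 a2 b c"
  have le_add: "ev_prob p G x1 x2 y z \<le> ev_prob p H x1 x2 y z + ev_prob p ?D x1 x2 y z"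
    if "\<And>a1 a2 b c. G a1 a2 b c \<Longrightarrow> H a1 a2 b c \<or> ?D a1 a2 b c" for G H
    using that by (rule order_trans[OF ev_prob_mono[OF assms] ev_prob_disj_le[OF assms]])
  have "ev_prob p E x1 x2 y z \<le> ev_prob p F x1 x2 y z + ev_prob p ?D x1 x2 y z"
    by (rule le_add) blast
  moreover have "ev_prob p F x1 x2 y z \<le> ev_prob p E x1 x2 y z + ev_prob p ?D x1 x2 y z"
    by (rule le_add) blast
  ultimately show ?thesis
    unfolding ev_prob_not[OF assms] by (simp add: abs_le_iff)
qed

lemma ev_prob_linear:
  "ev_prob (\<lambda>a1 a2 b c x1 x2 y z. s * p a1 a2 b c x1 x2 y z + t * q a1 a2 b c x1 x2 y z) E x1 x2 y z
    = s * ev_prob p E x1 x2 y z + t * ev_prob q E x1 x2 y z"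
  unfolding ev_prob_def sum_distrib_left sum.distrib[symmetric]
  by (intro sum.cong refl) simp

subsection \<open>Independence in terms of events\<close>

lemma NS_ev_prob_b_indep:
  assumes "p \<in> NS"
  shows "ev_prob p (\<lambda>a1 a2 b c. E b) x1 x2 y z = ev_prob p (\<lambda>a1 a2 b c. E b) x1' x2' y z'"
proof -
  have expand: "ev_prob p (\<lambda>a1 a2 b c. E b) x1 x2 y z
      = (\<Sum>b\<in>UNIV. of_bool (E b) * (\<Sum>a1\<in>UNIV. \<Sum>a2\<in>UNIV. \<Sum>c\<in>UNIV. p a1 a2 b c x1 x2 y z))"
    for x1 x2 z
    by (simp add: ev_prob_eq_sum_of_bool UNIV_bool algebra_simps)
  have marginal: "(\<Sum>a1\<in>UNIV. \<Sum>a2\<in>UNIV. \<Sum>c\<in>UNIV. p a1 a2 b c x1 x2 y z)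
      = (\<Sum>a1\<in>UNIV. \<Sum>a2\<in>UNIV. \<Sum>c\<in>UNIV. p a1 a2 b c x1' x2' y z')" for b
    using assms unfolding NS_def by blast
  show ?thesis
    unfolding expand marginal ..
qed

lemma NS_ev_prob_a1_a2_c_indep:
  assumes "p \<in> NS"
  shows "ev_prob p (\<lambda>a1 a2 b c. E a1 a2 c) x1 x2 y z = ev_prob p (\<lambda>a1 a2 b c. E a1 a2 c) x1 x2 y' z"
proof -
  have expand: "ev_prob p (\<lambda>a1 a2 b c. E a1 a2 c) x1 x2 y z
      = (\<Sum>a1\<in>UNIV. \<Sum>a2\<in>UNIV. \<Sum>c\<in>UNIV.
          of_bool (E a1 a2 c) * (\<Sum>b\<in>UNIV. p a1 a2 b c x1 x2 y z))" for y
    by (simp add: ev_prob_eq_sum_of_bool UNIV_bool algebra_simps)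
  have marginal: "(\<Sum>b\<in>UNIV. p a1 a2 b c x1 x2 y z) = (\<Sum>b\<in>UNIV. p a1 a2 b c x1 x2 y' z)"
    for a1 a2 c
    using assms unfolding NS_def by blast
  show ?thesis
    unfolding expand marginal ..
qed

lemma LC1_ev_prob_a1_b_indep:
  assumes "p \<in> LC1"
  shows "ev_prob p (\<lambda>a1 a2 b c. E a1 b) x1 x2 y z = ev_prob p (\<lambda>a1 a2 b c. E a1 b) x1 x2' y z"
proof -
  have expand: "ev_prob p (\<lambda>a1 a2 b c. E a1 b) x1 x2 y z
      = (\<Sum>a1\<in>UNIV. \<Sum>b\<in>UNIV. of_bool (E a1 b) * (\<Sum>a2\<in>UNIV. \<Sum>c\<in>UNIV. p a1 a2 b c x1 x2 y z))"
    for x2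
    by (simp add: ev_prob_eq_sum_of_bool UNIV_bool algebra_simps)
  have marginal: "(\<Sum>a2\<in>UNIV. \<Sum>c\<in>UNIV. p a1 a2 b c x1 x2 y z)
      = (\<Sum>a2\<in>UNIV. \<Sum>c\<in>UNIV. p a1 a2 b c x1 x2' y z)" for a1 b
    using assms unfolding LC1_def by blast
  show ?thesis
    unfolding expand marginal ..
qed

text \<open>The choice x1 = x2 = z = 0 is immaterial for no-signalling behaviours.\<close>

definition marginal_b :: "behav \<Rightarrow> bool \<Rightarrow> bool \<Rightarrow> real" where
  "marginal_b p b y = ev_prob p (\<lambda>a1 a2 b' c. b' = b) False False y False"

lemma ev_prob_b_eq_marginal_b:
  "p \<in> NS \<Longrightarrow> ev_prob p (\<lambda>a1 a2 b' c. b' = b) x1 x2 y z = marginal_b p b y"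
  unfolding marginal_b_def by (rule NS_ev_prob_b_indep)

lemma marginal_b_True:
  assumes "p \<in> NS"
  shows "marginal_b p True y = 1 - marginal_b p False y"
  using ev_prob_not[OF NS_imp_cond_dist[OF assms], of "\<lambda>a1 a2 b c. b = False"]
  by (simp add: marginal_b_def)

subsection \<open>The terms of the score\<close>

definition guess_prob :: "behav \<Rightarrow> (bool \<Rightarrow> bool \<Rightarrow> bool \<Rightarrow> bool \<Rightarrow> bool) \<Rightarrow> bool \<Rightarrow> bool \<Rightarrow> real" where
  "guess_prob p G b y = (1/8) * (\<Sum>x1\<in>UNIV. \<Sum>x2\<in>UNIV. \<Sum>z\<in>UNIV.
     ev_prob p (\<lambda>a1 a2 b' c. b' = b \<and> G a1 a2 x1 x2) x1 x2 y z)"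

definition chsh_prob :: "behav \<Rightarrow> bool \<Rightarrow> bool \<Rightarrow> real" where
  "chsh_prob p x1 x2 = (1/4) * (\<Sum>y\<in>UNIV. \<Sum>z\<in>UNIV.
     ev_prob p (\<lambda>a1 a2 b c. (b \<noteq> c) = (y \<and> z)) x1 x2 y z)"

lemma score_eq_guess_prob_chsh_prob:
  "score p = guess_prob p (\<lambda>a1 a2 x1 x2. a2 = x1) False False
    + guess_prob p (\<lambda>a1 a2 x1 x2. a1 = x2) True False + chsh_prob p False False"
  unfolding score_def guess_prob_def chsh_prob_def ..

lemma guess_prob_le_marginal_b:
  assumes "p \<in> NS"
  shows "guess_prob p G b y \<le> marginal_b p b y"
proof -
  have "ev_prob p (\<lambda>a1 a2 b' c. b' = b \<and> G a1 a2 x1 x2) x1 x2 y z \<le> marginal_b p b y" for x1 x2 z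
    unfolding ev_prob_b_eq_marginal_b[OF assms, of b x1 x2 y z, symmetric]
    by (rule ev_prob_mono[OF NS_imp_cond_dist[OF assms]]) blast
  then have "guess_prob p G b y \<le> (1/8) * (\<Sum>x1\<in>(UNIV::bool set). \<Sum>x2\<in>(UNIV::bool set).
      \<Sum>z\<in>(UNIV::bool set). marginal_b p b y)"
    unfolding guess_prob_def by (intro mult_left_mono sum_mono) simp_all
  then show ?thesis
    by simp
qed

lemma LC1_guess_prob_x2:
  assumes p: "p \<in> LC1"
  shows "guess_prob p (\<lambda>a1 a2 x1 x2. a1 = x2) b y = marginal_b p b y / 2"
proof -
  let ?hit = "\<lambda>x1 x2 z. ev_prob p (\<lambda>a1 a2 b' c. b' = b \<and> a1 = x2) x1 x2 y z"
  have hit: "(\<Sum>x2\<in>UNIV. ?hit x1 x2 z) = marginal_b p b y" for x1 z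
  proof -
    have "(\<Sum>x2\<in>UNIV. ?hit x1 x2 z)
        = (\<Sum>v\<in>UNIV. ev_prob p (\<lambda>a1 a2 b' c. b' = b \<and> a1 = v) x1 False y z)"
      by (intro sum.cong refl LC1_ev_prob_a1_b_indep[OF p])
    also have "\<dots> = marginal_b p b y"
      by (simp only: ev_prob_total ev_prob_b_eq_marginal_b[OF LC1_imp_NS[OF p]])
    finally show ?thesis .
  qed
  have "(\<Sum>x1\<in>UNIV. \<Sum>x2\<in>UNIV. \<Sum>z\<in>UNIV. ?hit x1 x2 z)
      = (\<Sum>x1\<in>UNIV. \<Sum>z\<in>UNIV. \<Sum>x2\<in>UNIV. ?hit x1 x2 z)"
    by (rule sum.cong[OF refl sum.swap])
  then show ?thesis
    by (simp add: guess_prob_def hit)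
qed

lemma chsh_round_loss_ge:
  assumes "p \<in> NS"
  shows "\<bar>marginal_b p False y - ev_prob p (\<lambda>a1 a2 b c. c = (y \<and> z)) x1 x2 y z\<bar>
    \<le> 1 - ev_prob p (\<lambda>a1 a2 b c. (b \<noteq> c) = (y \<and> z)) x1 x2 y z"
proof -
  have win: "(b = False) = (c = (y \<and> z)) \<longleftrightarrow> (b \<noteq> c) = (y \<and> z)" for b c
    by auto
  show ?thesis
    using abs_ev_prob_diff_le[OF NS_imp_cond_dist[OF assms],
        of "\<lambda>a1 a2 b c. b = False" x1 x2 y z "\<lambda>a1 a2 b c. c = (y \<and> z)"]
    unfolding win ev_prob_b_eq_marginal_b[OF assms] .
qed

text \<open>The four rounds form a cycle through the marginals of b and c. Losing a round is at least as
  likely as the difference of the two marginals it compares, and one round compares b with the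
  negation of c, so going once around the cycle from b leads to the negation of b.\<close>

lemma chsh_prob_le:
  assumes p: "p \<in> NS"
  shows "chsh_prob p x1 x2 \<le> 1 - \<bar>marginal_b p False y - marginal_b p True y\<bar> / 4"
proof -
  let ?win = "\<lambda>y z. ev_prob p (\<lambda>a1 a2 b c. (b \<noteq> c) = (y \<and> z)) x1 x2 y z"
  define c_zero where "c_zero z = ev_prob p (\<lambda>a1 a2 b c. \<not> c) x1 x2 False z" for z
  have c_zero: "ev_prob p (\<lambda>a1 a2 b c. \<not> c) x1 x2 y z = c_zero z" for y z
    unfolding c_zero_def by (rule NS_ev_prob_a1_a2_c_indep[OF p])
  have c_one: "ev_prob p (\<lambda>a1 a2 b c. c) x1 x2 y z = 1 - c_zero z" for y z
    using ev_prob_not[OF NS_imp_cond_dist[OF p], of "\<lambda>a1 a2 b c. \<not> c"] by (simp add: c_zero)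
  have loss: "\<bar>marginal_b p False y - (if y \<and> z then 1 - c_zero z else c_zero z)\<bar> \<le> 1 - ?win y z"
    for y z
    using chsh_round_loss_ge[OF p, of y z x1 x2]
    by (cases y; cases z) (simp_all add: c_zero c_one)
  have "\<bar>marginal_b p False y - (1 - marginal_b p False y)\<bar>
      \<le> (1 - ?win False False) + (1 - ?win False True) + (1 - ?win True False) + (1 - ?win True True)"
    using loss[of False False] loss[of False True] loss[of True False] loss[of True True]
    unfolding abs_le_iff by (cases y) simp_all
  also have "\<dots> = 4 - 4 * chsh_prob p x1 x2"
    by (simp add: chsh_prob_def UNIV_bool field_simps)
  finally show ?thesis
    by (simp add: marginal_b_True[OF p])
qed

subsection \<open>Exchanging the two parties\<close>

definition party_swap :: "behav \<Rightarrow> behav" where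
  "party_swap p = (\<lambda>a1 a2 b c x1 x2 y z. p a2 a1 (\<not> b) (\<not> c) x2 x1 y z)"

lemma score_party_swap: "score (party_swap p) = score p"
  by (simp add: score_def ev_prob_def party_swap_def UNIV_bool add_ac)

lemma cond_dist_party_swap:
  assumes "cond_dist p"
  shows "cond_dist (party_swap p)"
proof -
  have "(\<Sum>a1\<in>UNIV. \<Sum>a2\<in>UNIV. \<Sum>b\<in>UNIV. \<Sum>c\<in>UNIV. party_swap p a1 a2 b c x1 x2 y z)
      = (\<Sum>a1\<in>UNIV. \<Sum>a2\<in>UNIV. \<Sum>b\<in>UNIV. \<Sum>c\<in>UNIV. p a1 a2 b c x2 x1 y z)" for x1 x2 y z
    by (simp add: party_swap_def UNIV_bool)
  with assms show ?thesis
    by (simp add: cond_dist_def party_swap_def)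
qed

lemma party_swap_in_NS:
  assumes "p \<in> NS"
  shows "party_swap p \<in> NS"
proof -
  have sum_b: "(\<Sum>b\<in>UNIV. party_swap p a1 a2 b c x1 x2 y z)
      = (\<Sum>b\<in>UNIV. p a2 a1 b (\<not> c) x2 x1 y z)" for a1 a2 c x1 x2 y z
    by (simp add: party_swap_def UNIV_bool)
  have sum_a1_a2_c: "(\<Sum>a1\<in>UNIV. \<Sum>a2\<in>UNIV. \<Sum>c\<in>UNIV. party_swap p a1 a2 b c x1 x2 y z)
      = (\<Sum>a1\<in>UNIV. \<Sum>a2\<in>UNIV. \<Sum>c\<in>UNIV. p a1 a2 (\<not> b) c x2 x1 y z)" for b x1 x2 y z
    by (simp add: party_swap_def UNIV_bool)
  show ?thesis
    unfolding NS_def mem_Collect_eq sum_b sum_a1_a2_c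
    using assms cond_dist_party_swap unfolding NS_def by blast
qed

lemma party_swap_in_LC1:
  assumes "p \<in> LC2"
  shows "party_swap p \<in> LC1"
proof -
  have sum_a2_c: "(\<Sum>a2\<in>UNIV. \<Sum>c\<in>UNIV. party_swap p a1 a2 b c x1 x2 y z)
      = (\<Sum>a1'\<in>UNIV. \<Sum>c\<in>UNIV. p a1' a1 (\<not> b) c x2 x1 y z)" for a1 b x1 x2 y z
    by (simp add: party_swap_def UNIV_bool)
  have sum_c: "(\<Sum>c\<in>UNIV. party_swap p a1 a2 b c x1 x2 y z)
      = (\<Sum>c\<in>UNIV. p a2 a1 (\<not> b) c x2 x1 y z)" for a1 a2 b x1 x2 y z
    by (simp add: party_swap_def UNIV_bool)
  show ?thesis
    unfolding LC1_def ind_a1a2b_z_def mem_Collect_eq sum_a2_c sum_c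
    using assms party_swap_in_NS unfolding LC2_def ind_a1a2b_z_def by blast
qed

subsection \<open>The bound\<close>

lemma LC1_score_le:
  assumes p: "p \<in> LC1"
  shows "score p \<le> 7/4"
proof -
  have ns: "p \<in> NS"
    using p by (rule LC1_imp_NS)
  let ?\<beta> = "marginal_b p False False"
  have "guess_prob p (\<lambda>a1 a2 x1 x2. a2 = x1) False False \<le> ?\<beta>"
    by (rule guess_prob_le_marginal_b[OF ns])
  moreover have "guess_prob p (\<lambda>a1 a2 x1 x2. a1 = x2) True False = 1/2 - ?\<beta> / 2"
    by (simp add: LC1_guess_prob_x2[OF p] marginal_b_True[OF ns] diff_divide_distrib)
  moreover have "chsh_prob p False False \<le> 5/4 - ?\<beta> / 2"
    using chsh_prob_le[OF ns, of False False False] unfolding marginal_b_True[OF ns] by argo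
  ultimately show ?thesis
    unfolding score_eq_guess_prob_chsh_prob by linarith
qed

lemma LC2_score_le:
  assumes "p \<in> LC2"
  shows "score p \<le> 7/4"
  using LC1_score_le[OF party_swap_in_LC1[OF assms]] by (simp only: score_party_swap)

lemma score_linear:
  "score (\<lambda>a1 a2 b c x1 x2 y z. s * p a1 a2 b c x1 x2 y z + t * q a1 a2 b c x1 x2 y z)
    = s * score p + t * score q"
  unfolding score_def ev_prob_linear sum.distrib sum_distrib_left[symmetric]
  by (simp add: algebra_simps)

lemma LC_score_le:
  assumes "p \<in> LC"
  shows "score p \<le> 7/4"
proof -
  obtain \<mu> p1 p2 where \<mu>: "0 \<le> \<mu>" "\<mu> \<le> 1" and p1: "p1 \<in> LC1" and p2: "p2 \<in> LC2"
    and p: "p = (\<lambda>a1 a2 b c x1 x2 y z. \<mu> * p1 a1 a2 b c x1 x2 y z + (1 - \<mu>) * p2 a1 a2 b c x1 x2 y z)"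
    using assms unfolding LC_def by blast
  have "\<mu> * score p1 + (1 - \<mu>) * score p2 \<le> 7/4"
    using \<mu> LC1_score_le[OF p1] LC2_score_le[OF p2] by (intro convex_bound_le) simp_all
  then show ?thesis
    unfolding p score_linear .
qed

subsection \<open>Deterministic behaviours\<close>

definition det_behav :: "(bool \<Rightarrow> bool \<Rightarrow> bool) \<Rightarrow> (bool \<Rightarrow> bool \<Rightarrow> bool) \<Rightarrow> (bool \<Rightarrow> bool)
    \<Rightarrow> (bool \<Rightarrow> bool \<Rightarrow> bool \<Rightarrow> bool) \<Rightarrow> behav" where
  "det_behav f g h k = (\<lambda>a1 a2 b c x1 x2 y z.
     of_bool (a1 = f x1 x2) * of_bool (a2 = g x1 x2) * of_bool (b = h y) * of_bool (c = k x1 x2 z))"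

lemma ev_prob_det_behav:
  "ev_prob (det_behav f g h k) E x1 x2 y z = of_bool (E (f x1 x2) (g x1 x2) (h y) (k x1 x2 z))"
  by (cases "f x1 x2"; cases "g x1 x2"; cases "h y"; cases "k x1 x2 z")
    (simp_all add: ev_prob_def det_behav_def UNIV_bool)

lemma det_behav_in_NS: "det_behav f g h k \<in> NS"
  by (simp add: NS_def cond_dist_def det_behav_def
      flip: sum_distrib_left sum_distrib_right)

lemma det_behav_in_LC1: "det_behav (\<lambda>x1 x2. f x1) g h k \<in> LC1"
  using det_behav_in_NS
  by (simp add: LC1_def ind_a1a2b_z_def det_behav_def
      flip: sum_distrib_left sum_distrib_right)

lemma det_behav_in_LC2: "det_behav f (\<lambda>x1 x2. g x2) h k \<in> LC2"
  using det_behav_in_NS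
  by (simp add: LC2_def ind_a1a2b_z_def det_behav_def
      flip: sum_distrib_left sum_distrib_right)

text \<open>Copying x1 wins the first term; with b = c = 0 only the CHSH round y = z = 1 is lost.\<close>

definition copy_x1 :: behav where
  "copy_x1 = det_behav (\<lambda>x1 x2. False) (\<lambda>x1 x2. x1) (\<lambda>y. False) (\<lambda>x1 x2 z. False)"

lemma score_copy_x1: "score copy_x1 = 7/4"
  by (simp add: copy_x1_def score_def ev_prob_det_behav UNIV_bool)

lemma LC1_subset_LC: "LC1 \<subseteq> LC"
proof
  fix p assume "p \<in> LC1"
  moreover obtain q where "q \<in> LC2"
    using det_behav_in_LC2 by blast
  ultimately show "p \<in> LC"
    unfolding LC_def mem_Collect_eq by (intro exI[of _ 1] exI[of _ p] exI[of _ q]) simp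
qed

lemma copy_x1_in_LC: "copy_x1 \<in> LC"
  unfolding copy_x1_def by (rule subsetD[OF LC1_subset_LC det_behav_in_LC1])

theorem theorem1:
  shows "(\<forall>p\<in>LC. score p \<le> 7/4) \<and> (\<exists>p\<in>LC. score p = 7/4)"
  using LC_score_le score_copy_x1 copy_x1_in_LC by blast

end
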